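(* Let $n$ be a non-negative integer, let $b_1,\dots,b_n\in\mathbb{R}$, and let $\gamma_k = k^n+b_1k^{n-1}+b_2k^{n-2}+\cdots+b_n$ for $k=0,1,2,\dots$. Suppose that $\{\gamma_k\}_{k=0}^{\infty}$ is a multiplier sequence for the Chebyshev basis. Then $n$ is even and $b_i=0$ for every odd $i$ with $1\le i\le n$. That is, the polynomial interpolating the sequence $\{\gamma_k\}$ has no odd powers; it is an even function.
   Context: A polynomial in $\mathbb{R}[x]$ is hyperbolic if it either has only real zeros or is identically zero (nonzero constants, having no zeros, are hyperbolic). A linear operator $K$ on $\mathbb{R}[x]$ is hyperbolicity preserving if $K(p)$ is hyperbolic whenever $p$ is hyperbolic. The Chebyshev polynomials (of the first kind) $\{T_k\}_{k=0}^\infty$ are the unique polynomials satisfying $T_k(\cos\theta)=\cos(k\theta)$; they form a basis of $\mathbb{R}[x]$. A sequence of real numbers $\{\gamma_k\}_{k=0}^\infty$ is a multiplier sequence for the Chebyshev basis if the linear operator $K$ on $\mathbb{R}[x]$ determined by $K[\sum_{k=0}^{m} a_kT_k(x)]=\sum_{k=0}^{m}\gamma_k a_kT_k(x)$ is hyperbolicity preserving. Convention: $0^0=1$ (so for $n=0$ the sequence is constantly $1$). *)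

theory Defs
  imports Complex_Main "HOL-Computational_Algebra.Polynomial"
begin

text \<open>The zeros of a real polynomial are understood to be its complex zeros.\<close>

definition hyperbolic :: "real poly \<Rightarrow> bool" where
  "hyperbolic p \<longleftrightarrow> p = 0 \<or> (\<forall>z::complex. poly (map_poly complex_of_real p) z = 0 \<longrightarrow> z \<in> \<real>)"

definition hyperbolicity_preserving :: "(real poly \<Rightarrow> real poly) \<Rightarrow> bool" where
  "hyperbolicity_preserving K \<longleftrightarrow> (\<forall>p. hyperbolic p \<longrightarrow> hyperbolic (K p))"

definition Cheb :: "nat \<Rightarrow> real poly" where
  "Cheb k = (THE p. \<forall>\<theta>::real. poly p (cos \<theta>) = cos (real k * \<theta>))"

definition Cheb_diagonal :: "(nat \<Rightarrow> real) \<Rightarrow> (real poly \<Rightarrow> real poly) \<Rightarrow> bool" where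
  "Cheb_diagonal \<gamma> K \<longleftrightarrow> Vector_Spaces.linear smult smult K \<and>
     (\<forall>(m::nat) a. K (\<Sum>k\<le>m. smult (a k) (Cheb k)) = (\<Sum>k\<le>m. smult (\<gamma> k * a k) (Cheb k)))"

text \<open>The operator below exists and is unique: see \<open>ex1_Cheb_diagonal\<close>.\<close>

definition Cheb_multiplier_sequence :: "(nat \<Rightarrow> real) \<Rightarrow> bool" where
  "Cheb_multiplier_sequence \<gamma> \<longleftrightarrow> (\<exists>K. Cheb_diagonal \<gamma> K \<and> hyperbolicity_preserving K)"

lemma ex_Cheb:
  "\<exists>p::real poly. degree p = k \<and> (\<forall>\<theta>::real. poly p (cos \<theta>) = cos (real k * \<theta>))"
proof (induction k rule: less_induct)
  case (less k)
  consider "k = 0" | "k = 1" | j where "k = Suc (Suc j)"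
    by (metis One_nat_def not0_implies_Suc)
  then show ?case
  proof cases
    case 1
    then show ?thesis by (intro exI[of _ 1]) auto
  next
    case 2
    then show ?thesis by (intro exI[of _ "[:0, 1:]"]) auto
  next
    case (3 j)
    obtain p where p: "degree p = j" "\<And>\<theta>::real. poly p (cos \<theta>) = cos (real j * \<theta>)"
      using less[of j] 3 by auto
    obtain q where q: "degree q = Suc j" "\<And>\<theta>::real. poly q (cos \<theta>) = cos (real (Suc j) * \<theta>)"
      using less[of "Suc j"] 3 by auto
    let ?r = "pCons 0 (smult 2 q) - p"
    have "q \<noteq> 0" using q(1) by auto
    then have "degree (pCons 0 (smult 2 q)) = Suc (Suc j)"
      using q(1) by simp
    moreover have "degree ?r = degree (pCons 0 (smult 2 q))"
      using p(1) calculation degree_add_eq_left[of "- p" "pCons 0 (smult 2 q)"] by simp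
    moreover have "poly ?r (cos \<theta>) = cos (real k * \<theta>)" for \<theta> :: real
    proof -
      have "cos (real k * \<theta>) = cos (real (Suc j) * \<theta> + \<theta>)"
        using 3 by (simp add: algebra_simps)
      moreover have "cos (real j * \<theta>) = cos (real (Suc j) * \<theta> - \<theta>)"
        by (simp add: algebra_simps)
      ultimately show ?thesis
        by (simp only: poly_diff poly_pCons poly_smult p q cos_add cos_diff) simp
    qed
    ultimately show ?thesis using 3 by (intro exI[of _ ?r]) auto
  qed
qed

lemma Cheb_unique:
  fixes p q :: "real poly"
  assumes "\<And>\<theta>. poly p (cos \<theta>) = cos (real k * \<theta>)" "\<And>\<theta>. poly q (cos \<theta>) = cos (real k * \<theta>)"
  shows "p = q"
proof -
  have "{-1..1} \<subseteq> {x. poly (p - q) x = 0}"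
  proof
    fix x :: real assume "x \<in> {-1..1}"
    then have "cos (arccos x) = x" by (intro cos_arccos) auto
    with assms[of "arccos x"] show "x \<in> {x. poly (p - q) x = 0}" by simp
  qed
  then have "infinite {x. poly (p - q) x = 0}"
    by (rule infinite_super) (simp add: infinite_Icc_iff)
  then have "p - q = 0" using poly_roots_finite by blast
  then show ?thesis by simp
qed

lemma Cheb_props: "degree (Cheb k) = k" "poly (Cheb k) (cos \<theta>) = cos (real k * \<theta>)"
proof -
  obtain p :: "real poly" where p: "degree p = k" "\<forall>\<theta>. poly p (cos \<theta>) = cos (real k * \<theta>)"
    using ex_Cheb by blast
  have "Cheb k = p"
    unfolding Cheb_def
    by (rule the_equality) (use p Cheb_unique in auto)
  with p show "degree (Cheb k) = k" "poly (Cheb k) (cos \<theta>) = cos (real k * \<theta>)" by auto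
qed

lemma Cheb_nonzero: "Cheb k \<noteq> 0"
  using Cheb_props(2)[of k 0] by auto

lemma Cheb_sum_degree: "degree (\<Sum>k<m. smult (a k) (Cheb k)) \<le> m - 1"
proof (rule degree_sum_le)
  fix k assume "k \<in> {..<m}"
  then show "degree (smult (a k) (Cheb k)) \<le> m - 1"
    using degree_smult_le[of "a k" "Cheb k"] Cheb_props(1)[of k] by auto
qed auto

lemma Cheb_sum_zero:
  "(\<Sum>k<m. smult (a k) (Cheb k)) = 0 \<Longrightarrow> k < m \<Longrightarrow> a k = 0"
proof (induction m)
  case (Suc m)
  have "a m = 0"
  proof (cases m)
    case 0
    then show ?thesis using Suc.prems Cheb_nonzero by auto
  next
    case (Suc j)
    have "coeff (\<Sum>k<m. smult (a k) (Cheb k)) m = 0"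
      using Cheb_sum_degree[of a m] Suc by (intro coeff_eq_0) auto
    then have "a m * coeff (Cheb m) m = 0"
      using arg_cong[OF Suc.prems(1), of "\<lambda>p. coeff p m"] by simp
    moreover have "coeff (Cheb m) m \<noteq> 0"
      using Cheb_nonzero[of m] Cheb_props(1)[of m] by (metis leading_coeff_0_iff)
    ultimately show ?thesis by simp
  qed
  then show ?case using Suc by (cases "k = m") auto
qed auto

lemma Cheb_expansion: "\<exists>a. p = (\<Sum>k\<le>degree p. smult (a k) (Cheb k))"
proof -
  have "\<exists>a. p = (\<Sum>k<m. smult (a k) (Cheb k))" if "\<forall>i\<ge>m. coeff p i = 0" for m p
    using that
  proof (induction m arbitrary: p)
    case 0
    then show ?case by (auto simp: poly_eq_iff)
  next
    case (Suc m)
    let ?c = "coeff p m / coeff (Cheb m) m"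
    have lc: "coeff (Cheb m) m \<noteq> 0"
      using Cheb_nonzero[of m] Cheb_props(1)[of m] by (metis leading_coeff_0_iff)
    have "\<forall>i\<ge>m. coeff (p - smult ?c (Cheb m)) i = 0"
    proof (intro allI impI)
      fix i assume "i \<ge> m"
      then consider "i = m" | "i > m" by linarith
      then show "coeff (p - smult ?c (Cheb m)) i = 0"
      proof cases
        case 1
        then show ?thesis using lc by simp
      next
        case 2
        then have "coeff (Cheb m) i = 0"
          using Cheb_props(1)[of m] by (intro coeff_eq_0) auto
        then show ?thesis using Suc.prems 2 by simp
      qed
    qed
    from Suc.IH[OF this] obtain a
      where a: "p - smult ?c (Cheb m) = (\<Sum>k<m. smult (a k) (Cheb k))" by blast
    have "(\<Sum>k<m. smult ((a(m := ?c)) k) (Cheb k)) = (\<Sum>k<m. smult (a k) (Cheb k))"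
      by (intro sum.cong) auto
    then have "p = (\<Sum>k<Suc m. smult ((a(m := ?c)) k) (Cheb k))"
      using a by (simp add: algebra_simps)
    then show ?case by blast
  qed
  from this[of "Suc (degree p)" p] show ?thesis
    by (simp add: coeff_eq_0 lessThan_Suc_atMost)
qed

lemma vector_space_smult: "vector_space (smult :: real \<Rightarrow> real poly \<Rightarrow> real poly)"
  by unfold_locales (simp_all add: smult_add_right smult_add_left)

lemma ex1_Cheb_diagonal: "\<exists>!K. Cheb_diagonal \<gamma> K"
proof (rule ex_ex1I)
  interpret V: vector_space "smult :: real \<Rightarrow> real poly \<Rightarrow> real poly"
    by (rule vector_space_smult)
  interpret P: vector_space_pair "smult :: real \<Rightarrow> real poly \<Rightarrow> real poly"
    "smult :: real \<Rightarrow> real poly \<Rightarrow> real poly"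
    by unfold_locales
  have inj: "inj Cheb" by (metis Cheb_props(1) injI)
  have "V.independent (range Cheb)"
    unfolding V.independent_explicit_module
  proof (intro allI impI)
    fix t u v
    assume t: "finite t" "t \<subseteq> range Cheb" and z: "(\<Sum>v\<in>t. smult (u v) v) = 0" and v: "v \<in> t"
    obtain J where J: "t = Cheb ` J" using t(2) by (meson subset_imageE)
    then have "finite J" using t(1) inj by (metis finite_imageD inj_on_subset top_greatest)
    then obtain m where m: "J \<subseteq> {..<m}" using finite_nat_iff_bounded by auto
    let ?a = "\<lambda>k. if k \<in> J then u (Cheb k) else 0"
    have "(\<Sum>v\<in>t. smult (u v) v) = (\<Sum>k\<in>J. smult (u (Cheb k)) (Cheb k))"
      unfolding J by (subst sum.reindex) (use inj in \<open>auto intro: inj_on_subset\<close>)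
    also have "\<dots> = (\<Sum>k<m. smult (?a k) (Cheb k))"
      using m by (intro sum.mono_neutral_cong_left) auto
    finally have 0: "(\<Sum>k<m. smult (?a k) (Cheb k)) = 0" using z by simp
    obtain k where k: "k \<in> J" "v = Cheb k" using v J by auto
    then show "u v = 0" using Cheb_sum_zero[OF 0, of k] m by auto
  qed
  then obtain K where K: "Vector_Spaces.linear smult smult K"
    "\<forall>p\<in>range Cheb. K p = smult (\<gamma> (inv Cheb p)) p"
    using P.linear_independent_extend[of "range Cheb" "\<lambda>p. smult (\<gamma> (inv Cheb p)) p"] by blast
  interpret K: Vector_Spaces.linear smult smult K by (rule K(1))
  have "K (\<Sum>k\<le>m. smult (a k) (Cheb k)) = (\<Sum>k\<le>m. smult (\<gamma> k * a k) (Cheb k))" for m :: nat and a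
    using K(2) inj by (simp add: K.sum K.scale mult.commute)
  then show "\<exists>K. Cheb_diagonal \<gamma> K"
    using K(1) unfolding Cheb_diagonal_def by blast
next
  fix K L assume *: "Cheb_diagonal \<gamma> K" "Cheb_diagonal \<gamma> L"
  show "K = L"
  proof
    fix p
    obtain m :: nat and a where p: "p = (\<Sum>k\<le>m. smult (a k) (Cheb k))"
      using Cheb_expansion by blast
    have "M p = (\<Sum>k\<le>m. smult (\<gamma> k * a k) (Cheb k))" if "Cheb_diagonal \<gamma> M" for M
      using that unfolding Cheb_diagonal_def p by blast
    from this[OF *(1)] this[OF *(2)] show "K p = L p" by (rule trans[OF _ sym])
  qed
qed

end

theory Submission
  imports Defs "HOL-Computational_Algebra.Fundamental_Theorem_Algebra"
begin

text \<open>Write \<open>\<gamma>\<^sub>k = E(k\<^sup>2) + k Q(k\<^sup>2)\<close> with polynomials \<open>E\<close> and \<open>Q\<close>. The claim is that \<open>Q = 0\<close>;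
the parity of \<open>n\<close> and the vanishing of the odd-indexed \<open>b\<^sub>i\<close> are then read off the coefficients.

The test polynomials are \<open>f = x\<^sup>2\<^sup>m (1 - x\<^sup>2)\<^sup>N\<close>, which are hyperbolic. Put \<open>q = K f\<close>. Since
\<open>T\<^sub>k''(0) = - k\<^sup>2 T\<^sub>k(0)\<close>, the number \<open>- q''(0)\<close> arises from \<open>f\<close> and the sequence \<open>k\<^sup>2 \<gamma>\<^sub>k\<close> in the same
way as \<open>q(0)\<close> does from \<open>f\<close> and \<open>\<gamma>\<^sub>k\<close>. As \<open>f\<close> is even, \<open>q'(0) = 0\<close>, and the Laguerre inequality
\<open>q q'' \<le> q'\<^sup>2\<close> for the hyperbolic polynomial \<open>q\<close> becomes \<open>q(0) q''(0) \<le> 0\<close>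
(\<open>multiplier_bump_mean_product\<close>).

The odd part \<open>k Q(k\<^sup>2)\<close> breaks this inequality. In the variable \<open>x = cos \<theta>\<close>, multiplying the Chebyshev
coefficients by \<open>k\<^sup>2\<close> is the differential operator \<open>- d\<^sup>2/d\<theta>\<^sup>2\<close>. So \<open>E(k\<^sup>2)\<close> acts locally and contributes
nothing at a zero of high order, which \<open>f\<close> has at \<open>0\<close> (\<open>bump_mean_even\<close>). The operator with
multiplier \<open>k\<^sup>2\<^sup>d\<^sup>+\<^sup>1\<close>, in contrast, is nonlocal: at \<open>0\<close> it integrates \<open>f\<close> against a kernel of size
\<open>\<phi>\<^sup>-\<^sup>2\<^sup>d\<^sup>-\<^sup>2\<close> near \<open>\<phi> = \<theta> - \<pi>/2 = 0\<close>, whose sign alternates with \<open>d\<close>. As \<open>N\<close> grows, \<open>f\<close> concentrates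
near \<open>0\<close> and the top power of the odd part dominates, so if \<open>Q \<noteq> 0\<close> then the values for \<open>\<gamma>\<^sub>k\<close> and
for \<open>k\<^sup>2 \<gamma>\<^sub>k\<close> eventually have opposite signs, contradicting the inequality
(\<open>bump_mean_odd_limit\<close>, \<open>odd_limit_sign\<close>, \<open>multiplier_odd_part_zero\<close>).

All of this can be computed in closed form without integrals. The Chebyshev coefficients of
\<open>(1 - x\<^sup>2)\<^sup>M\<close> are, up to sign, the distribution of a simple random walk of \<open>2M\<close> steps, so \<open>q(0)\<close> is an
\<open>m\<close>-fold difference in \<open>M\<close> of a mean of \<open>\<gamma>\<close> over the distance of that walk from its start. In a
suitable basis of the polynomials in \<open>k\<close> such means are quotients of Gamma functions, and so are
their differences (\<open>walk_mean_ladder\<close>, \<open>bump_mean_pochhammer\<close>).\<close>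

section \<open>The Laguerre inequality for hyperbolic polynomials\<close>

lemma poly_map_poly_of_real_pCons:
  "poly (map_poly complex_of_real (pCons a p)) z = of_real a + z * poly (map_poly complex_of_real p) z"
  by (simp add: map_poly_pCons)

lemma poly_map_poly_of_real_add:
  "poly (map_poly complex_of_real (p + q)) z =
     poly (map_poly complex_of_real p) z + poly (map_poly complex_of_real q) z"
proof -
  have "map_poly complex_of_real (p + q) = map_poly complex_of_real p + map_poly complex_of_real q"
    by (rule poly_eqI) (simp add: coeff_map_poly)
  then show ?thesis by simp
qed

lemma poly_map_poly_of_real_mult:
  "poly (map_poly complex_of_real (p * q)) z =
     poly (map_poly complex_of_real p) z * poly (map_poly complex_of_real q) z"
  by (induction p)
    (simp_all add: poly_map_poly_of_real_pCons poly_map_poly_of_real_add map_poly_smult algebra_simps)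

lemma poly_map_poly_of_real_power:
  "poly (map_poly complex_of_real (p ^ n)) z = poly (map_poly complex_of_real p) z ^ n"
  by (induction n) (simp_all add: poly_map_poly_of_real_mult)

lemma poly_map_poly_of_real_of_real:
  "poly (map_poly complex_of_real p) (of_real x) = of_real (poly p x)"
  by (induction p) (simp_all add: poly_map_poly_of_real_pCons)

text \<open>Splitting off a real zero, \<open>q = (x - r) h\<close>, gives
\<open>q'\<^sup>2 - q q'' = h\<^sup>2 + (x - r)\<^sup>2 (h'\<^sup>2 - h h'')\<close>, so the inequality passes from \<open>h\<close> to \<open>q\<close>. The zero
exists by the fundamental theorem of algebra and is real by hyperbolicity.\<close>

lemma hyperbolic_Laguerre:
  assumes "hyperbolic q"
  shows "poly q x * poly (pderiv (pderiv q)) x \<le> (poly (pderiv q) x)\<^sup>2"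
  using assms
proof (induction "degree q" arbitrary: q rule: less_induct)
  case less
  show ?case
  proof (cases "degree q = 0")
    case True
    then have "pderiv q = 0" by (simp add: pderiv_eq_0_iff)
    then show ?thesis by simp
  next
    case False
    then have "q \<noteq> 0" by auto
    have "degree (map_poly complex_of_real q) \<noteq> 0"
      using False by (simp add: degree_map_poly)
    then have "\<nexists>a l. a \<noteq> 0 \<and> l = 0 \<and> map_poly complex_of_real q = pCons a l"
      by (metis degree_pCons_0)
    then obtain z where z: "poly (map_poly complex_of_real q) z = 0"
      using fundamental_theorem_of_algebra_alt by blast
    then have "z \<in> \<real>" using less.prems \<open>q \<noteq> 0\<close> unfolding hyperbolic_def by blast
    then obtain r where "z = of_real r" by (elim Reals_cases)
    then have "poly q r = 0" using z by (simp add: poly_map_poly_of_real_of_real)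
    then obtain h where h: "q = [:-r, 1:] * h" by (auto simp: poly_eq_0_iff_dvd)
    then have "h \<noteq> 0" using \<open>q \<noteq> 0\<close> by auto
    have "degree h < degree q"
      using \<open>h \<noteq> 0\<close> unfolding h by (subst degree_mult_eq) auto
    moreover have "hyperbolic h"
      using less.prems \<open>q \<noteq> 0\<close> unfolding hyperbolic_def h
      by (auto simp: poly_map_poly_of_real_mult simp del: mult_pCons_left)
    ultimately have "poly h x * poly (pderiv (pderiv h)) x \<le> (poly (pderiv h) x)\<^sup>2"
      using less.hyps by blast
    then have "0 \<le> (poly h x)\<^sup>2 + (x - r)\<^sup>2 *
        ((poly (pderiv h) x)\<^sup>2 - poly h x * poly (pderiv (pderiv h)) x)"
      by simp
    also have "\<dots> = (poly (pderiv q) x)\<^sup>2 - poly q x * poly (pderiv (pderiv q)) x"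
    proof -
      have "pderiv q = h + [:-r, 1:] * pderiv h"
        unfolding h pderiv_mult by (simp add: pderiv_pCons)
      moreover have "pderiv (h + [:-r, 1:] * pderiv h) = pderiv h + pderiv h + [:-r, 1:] * pderiv (pderiv h)"
        unfolding pderiv_add pderiv_mult by (simp add: pderiv_pCons)
      ultimately have eqs: "poly q x = (x - r) * poly h x"
        "poly (pderiv q) x = poly h x + (x - r) * poly (pderiv h) x"
        "poly (pderiv (pderiv q)) x = 2 * poly (pderiv h) x + (x - r) * poly (pderiv (pderiv h)) x"
        unfolding h by (simp_all only: poly_add poly_mult) (simp_all add: algebra_simps)
      show ?thesis unfolding eqs by (simp add: power2_eq_square algebra_simps)
    qed
    finally show ?thesis by simp
  qed
qed

section \<open>Chebyshev polynomials at the origin\<close>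

lemma pderiv_sum: "pderiv (sum f A) = (\<Sum>x\<in>A. pderiv (f x))"
  using higher_pderiv_sum[of 1 f A] by simp

lemma poly_eq_if_eq_on_cos:
  fixes p q :: "real poly"
  assumes "\<And>\<theta>. poly p (cos \<theta>) = poly q (cos \<theta>)"
  shows "p = q"
proof -
  have "{-1..1} \<subseteq> {x. poly (p - q) x = 0}"
  proof
    fix x :: real assume "x \<in> {-1..1}"
    then have "cos (arccos x) = x" by (intro cos_arccos) auto
    with assms[of "arccos x"] show "x \<in> {x. poly (p - q) x = 0}" by simp
  qed
  then have "infinite {x. poly (p - q) x = 0}"
    by (rule infinite_super) (simp add: infinite_Icc_iff)
  then show ?thesis using poly_roots_finite[of "p - q"] by auto
qed

lemma Cheb_deriv:
  "poly (pderiv (Cheb k)) (cos \<theta>) * sin \<theta> = real k * sin (real k * \<theta>)"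
proof -
  have 1: "((\<lambda>\<theta>. poly (Cheb k) (cos \<theta>)) has_real_derivative
      poly (pderiv (Cheb k)) (cos \<theta>) * (- sin \<theta>)) (at \<theta>)"
    by (rule DERIV_chain2) (auto intro!: derivative_eq_intros)
  have 2: "((\<lambda>\<theta>. cos (real k * \<theta>)) has_real_derivative - sin (real k * \<theta>) * real k) (at \<theta>)"
    by (auto intro!: derivative_eq_intros)
  show ?thesis
    using DERIV_unique[OF 1[unfolded Cheb_props(2)] 2] by (simp add: mult.commute)
qed

text \<open>The origin is \<open>cos (\<pi>/2)\<close>, where \<open>sin\<close> equals \<open>1\<close>. Differentiating \<open>T\<^sub>k(cos \<theta>) = cos (k \<theta>)\<close> twice
there leaves the \<open>x\<close>-derivatives of \<open>T\<^sub>k\<close> without correction terms.\<close>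

lemma Cheb_at_0:
  shows "poly (Cheb k) 0 = cos (real k * (pi / 2))"
    and "poly (pderiv (Cheb k)) 0 = real k * sin (real k * (pi / 2))"
    and "poly (pderiv (pderiv (Cheb k))) 0 = - (real k)\<^sup>2 * cos (real k * (pi / 2))"
proof -
  show "poly (Cheb k) 0 = cos (real k * (pi / 2))"
    using Cheb_props(2)[of k "pi / 2"] by simp
  show "poly (pderiv (Cheb k)) 0 = real k * sin (real k * (pi / 2))"
    using Cheb_deriv[of k "pi / 2"] by simp
  have 1: "((\<lambda>\<theta>. poly (pderiv (Cheb k)) (cos \<theta>) * sin \<theta>) has_real_derivative
      poly (pderiv (Cheb k)) (cos (pi / 2)) * cos (pi / 2) +
      (poly (pderiv (pderiv (Cheb k))) (cos (pi / 2)) * (- sin (pi / 2))) * sin (pi / 2)) (at (pi / 2))"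
    by (rule DERIV_mult' DERIV_chain2 poly_DERIV DERIV_cos DERIV_sin)+
  have 2: "((\<lambda>\<theta>. real k * sin (real k * \<theta>)) has_real_derivative
      real k * (cos (real k * (pi / 2)) * real k)) (at (pi / 2))"
    by (auto intro!: derivative_eq_intros)
  show "poly (pderiv (pderiv (Cheb k))) 0 = - (real k)\<^sup>2 * cos (real k * (pi / 2))"
    using DERIV_unique[OF 1[unfolded Cheb_deriv] 2] by (simp add: power2_eq_square mult.commute)
qed

section \<open>Random walk means and powers of the squared sine\<close>

text \<open>The distance from the origin of a walk on the integers after \<open>2M\<close> unit steps of which \<open>j\<close> go down.\<close>

definition walk_dist :: "nat \<Rightarrow> nat \<Rightarrow> nat" where
  "walk_dist M j = nat \<bar>2 * int M - 2 * int j\<bar>"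

text \<open>The expectation of \<open>g\<close> over that distance for the simple random walk: all \<open>4\<^sup>M\<close> paths are
equally likely.\<close>

definition walk_mean :: "(nat \<Rightarrow> real) \<Rightarrow> nat \<Rightarrow> real" where
  "walk_mean g M = (\<Sum>j\<le>2 * M. real (2 * M choose j) * g (walk_dist M j)) / 4 ^ M"

lemma real_walk_dist: "real (walk_dist M j) = \<bar>2 * real M - 2 * real j\<bar>"
proof -
  have "real (walk_dist M j) = real_of_int \<bar>2 * int M - 2 * int j\<bar>"
    unfolding walk_dist_def by (subst of_nat_nat) simp_all
  then show ?thesis by simp
qed

lemma walk_dist_Suc_Suc: "walk_dist (Suc M) (Suc j) = walk_dist M j"
  by (simp add: walk_dist_def)

lemma cos_walk_dist: "cos (real (walk_dist M j) * \<theta>) = cos ((2 * real j - 2 * real M) * \<theta>)"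
proof (cases "j \<le> M")
  case True
  then have "real (walk_dist M j) * \<theta> = - ((2 * real j - 2 * real M) * \<theta>)"
    by (simp add: real_walk_dist algebra_simps)
  then show ?thesis by (metis cos_minus)
next
  case False
  then show ?thesis by (simp add: real_walk_dist algebra_simps)
qed

lemma cos_walk_dist_half_pi: "cos (real (walk_dist M j) * (pi / 2)) = (-1) ^ (M + j)"
proof -
  have "cos (real (walk_dist M j) * (pi / 2)) = cos (real j * pi - real M * pi)"
    unfolding cos_walk_dist by (simp add: algebra_simps)
  then show ?thesis by (simp add: cos_diff power_add)
qed

lemma sin_walk_dist_half_pi: "sin (real (walk_dist M j) * (pi / 2)) = 0"
  using sin_cos_squared_add[of "real (walk_dist M j) * (pi / 2)"]
  unfolding cos_walk_dist_half_pi by (simp flip: power_mult)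

lemma Cheb_walk_dist_at_0:
  shows "poly (Cheb (walk_dist M j)) 0 = (-1) ^ (M + j)"
    and "poly (pderiv (Cheb (walk_dist M j))) 0 = 0"
    and "poly (pderiv (pderiv (Cheb (walk_dist M j)))) 0 =
      - (real (walk_dist M j))\<^sup>2 * (-1) ^ (M + j)"
  unfolding Cheb_at_0 cos_walk_dist_half_pi sin_walk_dist_half_pi by simp_all

text \<open>The binomial expansion of \<open>(2 \<i> sin \<theta>)\<^sup>2\<^sup>M = (cis \<theta> - cis (- \<theta>))\<^sup>2\<^sup>M\<close>.\<close>

lemma sin_power_even_Fourier:
  "sin \<theta> ^ (2 * M) =
     (\<Sum>j\<le>2 * M. real (2 * M choose j) * (-1) ^ (M + j) * cos (real (walk_dist M j) * \<theta>)) / 4 ^ M"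
proof -
  have eq: "2 * \<i> * of_real (sin \<theta>) = cis \<theta> + (- cis (- \<theta>))"
    by (simp add: complex_eq_iff)
  have "(2 * \<i> * of_real (sin \<theta>)) ^ (2 * M) =
      (\<Sum>j\<le>2 * M. of_nat (2 * M choose j) * cis \<theta> ^ j * (- cis (- \<theta>)) ^ (2 * M - j))"
    unfolding eq by (rule binomial_ring)
  also have "\<dots> = (\<Sum>j\<le>2 * M. of_real (real (2 * M choose j) * (-1) ^ j) *
      cis ((2 * real j - 2 * real M) * \<theta>))"
  proof (rule sum.cong)
    fix j assume "j \<in> {..2 * M}"
    then have j: "j \<le> 2 * M" by simp
    have "(- cis (- \<theta>)) ^ (2 * M - j) = (-1) ^ (2 * M - j) * cis (- \<theta>) ^ (2 * M - j)"
      by (rule power_minus)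
    also have "(-1 :: complex) ^ (2 * M - j) = (-1) ^ j"
      using j by (simp add: minus_one_power_iff)
    finally have "cis \<theta> ^ j * (- cis (- \<theta>)) ^ (2 * M - j) =
        (-1) ^ j * cis (real j * \<theta> + real (2 * M - j) * (- \<theta>))"
      unfolding DeMoivre by (simp add: cis_mult)
    also have "real j * \<theta> + real (2 * M - j) * (- \<theta>) = (2 * real j - 2 * real M) * \<theta>"
      using j by (simp add: of_nat_diff algebra_simps)
    finally show "of_nat (2 * M choose j) * cis \<theta> ^ j * (- cis (- \<theta>)) ^ (2 * M - j) =
        of_real (real (2 * M choose j) * (-1) ^ j) * cis ((2 * real j - 2 * real M) * \<theta>)"
      by (simp add: mult.assoc)
  qed simp
  also have "Re \<dots> = (\<Sum>j\<le>2 * M. real (2 * M choose j) * (-1) ^ j * cos (real (walk_dist M j) * \<theta>))"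
    by (simp add: cos_walk_dist)
  also have "(2 * \<i> * complex_of_real (sin \<theta>)) ^ (2 * M) = of_real ((-4) ^ M * sin \<theta> ^ (2 * M))"
  proof -
    have "(2 * \<i> * complex_of_real (sin \<theta>))\<^sup>2 = of_real (-4 * (sin \<theta>)\<^sup>2)"
      by (simp add: power_mult_distrib)
    then show ?thesis by (simp only: power_mult power_mult_distrib of_real_power of_real_mult)
  qed
  finally have "(-4) ^ M * sin \<theta> ^ (2 * M) =
      (\<Sum>j\<le>2 * M. real (2 * M choose j) * (-1) ^ j * cos (real (walk_dist M j) * \<theta>))"
    by simp
  then have "(-1) ^ M * ((-4) ^ M * sin \<theta> ^ (2 * M)) =
      (\<Sum>j\<le>2 * M. real (2 * M choose j) * (-1) ^ (M + j) * cos (real (walk_dist M j) * \<theta>))"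
    by (simp only: sum_distrib_left power_add mult_ac)
  moreover have "(-1) ^ M * (-4) ^ M = (4 :: real) ^ M"
    unfolding power_mult_distrib[symmetric] by simp
  ultimately have "4 ^ M * sin \<theta> ^ (2 * M) =
      (\<Sum>j\<le>2 * M. real (2 * M choose j) * (-1) ^ (M + j) * cos (real (walk_dist M j) * \<theta>))"
    by (simp only: mult.assoc[symmetric])
  then show ?thesis by (subst eq_divide_eq) (simp add: mult.commute)
qed

lemma power_one_minus_square_Cheb:
  "[:1, 0, -1:] ^ M =
     (\<Sum>j\<le>2 * M. smult (real (2 * M choose j) * (-1) ^ (M + j) / 4 ^ M) (Cheb (walk_dist M j)))"
proof (rule poly_eq_if_eq_on_cos)
  fix \<theta> :: real
  have "poly ([:1, 0, -1:] ^ M) (cos \<theta>) = (1 - (cos \<theta>)\<^sup>2) ^ M"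
    by (simp add: power2_eq_square)
  also have "\<dots> = sin \<theta> ^ (2 * M)"
    by (simp add: sin_squared_eq power_mult)
  finally show "poly ([:1, 0, -1:] ^ M) (cos \<theta>) = poly (\<Sum>j\<le>2 * M.
      smult (real (2 * M choose j) * (-1) ^ (M + j) / 4 ^ M) (Cheb (walk_dist M j))) (cos \<theta>)"
    by (simp add: sin_power_even_Fourier poly_sum Cheb_props sum_divide_distrib)
qed

section \<open>The test polynomials\<close>

definition bump :: "nat \<Rightarrow> nat \<Rightarrow> real poly" where
  "bump m N = [:0, 0, 1:] ^ m * [:1, 0, -1:] ^ N"

text \<open>Because \<open>x\<^sup>2 = 1 - (1 - x\<^sup>2)\<close>, a factor \<open>x\<^sup>2\<close> is a difference in \<open>N\<close>. Everything linear in the test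
polynomial is therefore determined by its values on the powers of \<open>1 - x\<^sup>2\<close>.\<close>

lemma bump_Suc: "bump (Suc m) N = bump m N - bump m (Suc N)"
proof -
  have "bump (Suc m) N + bump m (Suc N) = ([:0, 0, 1:] + [:1, 0, -1:]) * bump m N"
    by (simp only: bump_def power_Suc distrib_right) (simp only: mult_ac)
  also have "[:0, 0, 1:] + [:1, 0, -1:] = (1 :: real poly)" by (simp add: one_pCons)
  finally show ?thesis by (simp add: eq_diff_eq)
qed

lemma hyperbolic_bump: "hyperbolic (bump m N)"
proof -
  have "z \<in> \<real>" if "poly (map_poly complex_of_real (bump m N)) z = 0" for z
  proof -
    have "(z * z) ^ m * (1 - z * z) ^ N = 0"
      using that by (simp add: bump_def poly_map_poly_of_real_mult poly_map_poly_of_real_power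
          poly_map_poly_of_real_pCons map_poly_pCons)
    then have "z * z = 0 \<or> z * z = 1" by auto
    then have "z = 0 \<or> z = 1 \<or> z = -1" by (metis mult_eq_0_iff square_eq_1_iff)
    then show ?thesis by auto
  qed
  then show ?thesis unfolding hyperbolic_def by blast
qed

text \<open>The value at \<open>0\<close> of the diagonal operator with multipliers \<open>g\<close> applied to \<open>bump m N\<close>, see below;
the recursion copies \<open>bump_Suc\<close>.\<close>

fun bump_mean :: "(nat \<Rightarrow> real) \<Rightarrow> nat \<Rightarrow> nat \<Rightarrow> real" where
  "bump_mean g 0 N = walk_mean g N"
| "bump_mean g (Suc m) N = bump_mean g m N - bump_mean g m (Suc N)"

text \<open>Only even indices occur in the expansion, so the first derivative vanishes. The signs
\<open>T\<^sub>k(0) = \<plusminus> 1\<close> cancel the alternating signs of the Chebyshev coefficients of \<open>(1 - x\<^sup>2)\<^sup>M\<close>, which is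
why positive weights remain.\<close>

lemma Cheb_diagonal_bump_at_0:
  assumes "Cheb_diagonal \<gamma> K"
  shows "poly (K (bump m N)) 0 = bump_mean \<gamma> m N"
    and "poly (pderiv (K (bump m N))) 0 = 0"
    and "poly (pderiv (pderiv (K (bump m N)))) 0 = - bump_mean (\<lambda>k. (real k)\<^sup>2 * \<gamma> k) m N"
proof -
  interpret K: Vector_Spaces.linear smult smult K
    using assms by (simp add: Cheb_diagonal_def)
  have diag: "K (Cheb k) = smult (\<gamma> k) (Cheb k)" for k
  proof -
    show ?thesis
      using conjunct2[OF assms[unfolded Cheb_diagonal_def], rule_format, of "\<lambda>i. if i = k then 1 else 0" k]
      by (simp add: if_distrib if_distribR cong: if_cong)
  qed
  have base: "K (bump 0 N) = (\<Sum>j\<le>2 * N. smult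
      (real (2 * N choose j) * (-1) ^ (N + j) / 4 ^ N * \<gamma> (walk_dist N j)) (Cheb (walk_dist N j)))" for N
    by (simp add: bump_def power_one_minus_square_Cheb K.sum K.scale diag)
  show "poly (K (bump m N)) 0 = bump_mean \<gamma> m N"
  proof (induction m arbitrary: N)
    case 0
    show ?case
      unfolding base poly_sum bump_mean.simps walk_mean_def sum_divide_distrib
      by (intro sum.cong) (simp_all add: Cheb_walk_dist_at_0 minus_one_power_iff)
  next
    case (Suc m)
    then show ?case by (simp only: bump_Suc K.diff poly_diff bump_mean.simps)
  qed
  show "poly (pderiv (K (bump m N))) 0 = 0"
  proof (induction m arbitrary: N)
    case 0
    show ?case
      unfolding base pderiv_sum poly_sum
      by (intro sum.neutral ballI) (simp add: pderiv_smult Cheb_walk_dist_at_0)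
  next
    case (Suc m)
    then show ?case by (simp only: bump_Suc K.diff pderiv_diff poly_diff)
  qed
  show "poly (pderiv (pderiv (K (bump m N)))) 0 = - bump_mean (\<lambda>k. (real k)\<^sup>2 * \<gamma> k) m N"
  proof (induction m arbitrary: N)
    case 0
    show ?case
      unfolding base pderiv_sum poly_sum bump_mean.simps walk_mean_def sum_divide_distrib sum_negf[symmetric]
      by (intro sum.cong) (simp_all add: pderiv_smult Cheb_walk_dist_at_0 minus_one_power_iff)
  next
    case (Suc m)
    then show ?case by (simp add: bump_Suc K.diff pderiv_diff)
  qed
qed

lemma multiplier_bump_mean_product:
  assumes "Cheb_multiplier_sequence \<gamma>"
  shows "0 \<le> bump_mean \<gamma> m N * bump_mean (\<lambda>k. (real k)\<^sup>2 * \<gamma> k) m N"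
proof -
  obtain K where K: "Cheb_diagonal \<gamma> K" "hyperbolicity_preserving K"
    using assms unfolding Cheb_multiplier_sequence_def by blast
  then have "hyperbolic (K (bump m N))"
    using hyperbolic_bump unfolding hyperbolicity_preserving_def by blast
  from hyperbolic_Laguerre[OF this, of 0] show ?thesis
    by (simp add: Cheb_diagonal_bump_at_0[OF K(1)])
qed

section \<open>Closed forms for the means\<close>

lemma walk_mean_add: "walk_mean (\<lambda>k. f k + g k) M = walk_mean f M + walk_mean g M"
  by (simp add: walk_mean_def distrib_left sum.distrib add_divide_distrib)

lemma walk_mean_cmult: "walk_mean (\<lambda>k. c * g k) M = c * walk_mean g M"
  by (simp add: walk_mean_def sum_distrib_left mult.left_commute)

lemma bump_mean_add: "bump_mean (\<lambda>k. f k + g k) m N = bump_mean f m N + bump_mean g m N"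
  by (induction m arbitrary: N) (simp_all add: walk_mean_add)

lemma bump_mean_cmult: "bump_mean (\<lambda>k. c * g k) m N = c * bump_mean g m N"
  by (induction m arbitrary: N) (simp_all add: walk_mean_cmult algebra_simps)

text \<open>With \<open>n = 2(M+1)\<close> and \<open>j = i+1\<close> this is \<open>j (n - j) C(n,j) = n (n - 1) C(n-2,j-1)\<close>.\<close>

lemma choose_product_absorb:
  assumes "i \<le> 2 * M"
  shows "real (Suc i) * (2 * real (Suc M) - real (Suc i)) * real (2 * Suc M choose Suc i) =
    2 * real (Suc M) * (2 * real (Suc M) - 1) * real (2 * M choose i)"
proof -
  have "Suc i * (Suc (Suc (2 * M)) choose Suc i) = Suc (Suc (2 * M)) * (Suc (2 * M) choose i)"
    by (rule Suc_times_binomial)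
  then have "real (Suc i) * real (Suc (Suc (2 * M)) choose Suc i) =
      real (Suc (Suc (2 * M))) * real (Suc (2 * M) choose i)"
    unfolding of_nat_mult[symmetric] by (simp only:)
  moreover have "2 * Suc M = Suc (Suc (2 * M))" "real (Suc (Suc (2 * M))) = 2 * real (Suc M)"
    by simp_all
  ultimately have 1: "real (Suc i) * real (2 * Suc M choose Suc i) =
      2 * real (Suc M) * real (Suc (2 * M) choose i)"
    by (simp only:)
  have "(Suc (2 * M) - i) * (Suc (2 * M) choose i) = Suc (2 * M) * (2 * M choose i)"
    using binomial_absorb_comp[of "Suc (2 * M)" i] by simp
  then have "real (Suc (2 * M) - i) * real (Suc (2 * M) choose i) = real (Suc (2 * M)) * real (2 * M choose i)"
    unfolding of_nat_mult[symmetric] by (simp only:)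
  then have 2: "(2 * real (Suc M) - real (Suc i)) * real (Suc (2 * M) choose i) =
      (2 * real (Suc M) - 1) * real (2 * M choose i)"
    using assms by (simp add: of_nat_diff algebra_simps)
  have "real (Suc i) * (2 * real (Suc M) - real (Suc i)) * real (2 * Suc M choose Suc i) =
      (2 * real (Suc M) - real (Suc i)) * (real (Suc i) * real (2 * Suc M choose Suc i))"
    by (simp only: mult_ac)
  also have "\<dots> = 2 * real (Suc M) * ((2 * real (Suc M) - real (Suc i)) * real (Suc (2 * M) choose i))"
    unfolding 1 by (simp only: mult_ac)
  finally show ?thesis unfolding 2 by (simp only: mult_ac)
qed

text \<open>With \<open>n = M+1\<close>, from \<open>(2n - 2j)\<^sup>2 = 4n\<^sup>2 - 4 j (2n - j)\<close>: the last product lowers the binomial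
coefficient to the walk that is two steps shorter. This is the counterpart of computing
\<open>d\<^sup>2/d\<theta>\<^sup>2\<close> of \<open>sin\<^sup>2\<^sup>n \<theta>\<close>.\<close>

lemma walk_mean_square_mult:
  "walk_mean (\<lambda>k. (real k)\<^sup>2 * g k) (Suc M) =
     4 * (real (Suc M))\<^sup>2 * walk_mean g (Suc M) -
     2 * real (Suc M) * (2 * real (Suc M) - 1) * walk_mean g M"
proof -
  let ?n = "real (Suc M)"
  let ?h = "\<lambda>j. real j * (2 * ?n - real j) * real (2 * Suc M choose j) * g (walk_dist (Suc M) j)"
  have sq: "(real (walk_dist (Suc M) j))\<^sup>2 = 4 * ?n\<^sup>2 - 4 * (real j * (2 * ?n - real j))" for j
    unfolding real_walk_dist by (simp add: power2_eq_square algebra_simps)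
  have "(\<Sum>j\<le>2 * Suc M. real (2 * Suc M choose j) *
        ((real (walk_dist (Suc M) j))\<^sup>2 * g (walk_dist (Suc M) j))) =
      (\<Sum>j\<le>2 * Suc M. 4 * ?n\<^sup>2 * (real (2 * Suc M choose j) * g (walk_dist (Suc M) j)) - 4 * ?h j)"
    unfolding sq by (intro sum.cong refl) (simp only: right_diff_distrib left_diff_distrib mult_ac)
  also have "\<dots> = 4 * ?n\<^sup>2 * (\<Sum>j\<le>2 * Suc M. real (2 * Suc M choose j) * g (walk_dist (Suc M) j)) -
      4 * (\<Sum>j\<le>2 * Suc M. ?h j)"
    by (simp only: sum_subtractf sum_distrib_left)
  also have "(\<Sum>j\<le>2 * Suc M. ?h j) = (\<Sum>i\<le>2 * M. ?h (Suc i))"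
  proof -
    have "(\<Sum>j\<le>2 * Suc M. ?h j) = (\<Sum>j\<le>Suc (Suc (2 * M)). ?h j)" by simp
    also have "\<dots> = ?h 0 + ((\<Sum>i\<le>2 * M. ?h (Suc i)) + ?h (Suc (Suc (2 * M))))"
      by (subst sum.atMost_Suc_shift, subst sum.atMost_Suc) (rule refl)
    finally show ?thesis by simp
  qed
  also have "\<dots> = 2 * ?n * (2 * ?n - 1) * (\<Sum>i\<le>2 * M. real (2 * M choose i) * g (walk_dist M i))"
    unfolding sum_distrib_left walk_dist_Suc_Suc
    by (intro sum.cong refl) (simp only: choose_product_absorb atMost_iff mult.assoc[symmetric])
  finally show ?thesis
    by (simp only: walk_mean_def) (simp add: diff_divide_distrib del: of_nat_Suc mult_Suc_right)
qed

lemma walk_mean_one: "walk_mean (\<lambda>k. 1) M = 1"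
proof -
  have "(\<Sum>j\<le>2 * M. real (2 * M choose j)) = 4 ^ M"
    unfolding of_nat_sum[symmetric] choose_row_sum by (simp add: power_mult)
  then show ?thesis by (simp add: walk_mean_def)
qed

text \<open>With \<open>G(j) = j C(2M,j)\<close> one has \<open>G(j+1) - G(j) = (2M - 2j) C(2M,j)\<close>, so both halves of the sum
telescope to \<open>G(M)\<close>. Together with the constant sequence, this is the initial value from which
the recursion for \<open>k\<^sup>2\<close> produces all moments.\<close>

lemma walk_mean_id: "walk_mean real M = 2 * real M * pochhammer (1 / 2) M / fact M"
proof -
  let ?G = "\<lambda>j. real j * real (2 * M choose j)"
  have step: "?G (Suc j) - ?G j = (2 * real M - 2 * real j) * real (2 * M choose j)" if "j \<le> 2 * M" for j
  proof -
    have "Suc j * (2 * M choose Suc j) = (2 * M - j) * (2 * M choose j)"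
      by (metis binomial_absorb_comp binomial_absorption)
    then have "real (Suc j) * real (2 * M choose Suc j) = real (2 * M - j) * real (2 * M choose j)"
      unfolding of_nat_mult[symmetric] by (simp only:)
    then show ?thesis using that by (simp add: of_nat_diff algebra_simps)
  qed
  have "(\<Sum>j\<le>2 * M. real (2 * M choose j) * real (walk_dist M j)) =
      (\<Sum>j<M. real (2 * M choose j) * real (walk_dist M j)) +
      (\<Sum>j=M..2 * M. real (2 * M choose j) * real (walk_dist M j))"
  proof -
    have "{..2 * M} = {..<M} \<union> {M..2 * M}" by auto
    then show ?thesis by (simp add: sum.union_disjoint ivl_disj_int)
  qed
  also have "(\<Sum>j<M. real (2 * M choose j) * real (walk_dist M j)) = (\<Sum>j<M. ?G (Suc j) - ?G j)"
    by (intro sum.cong refl) (simp only: step lessThan_iff, simp add: real_walk_dist)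
  also have "\<dots> = ?G M" by (subst sum_lessThan_telescope) simp
  also have "(\<Sum>j=M..2 * M. real (2 * M choose j) * real (walk_dist M j)) =
      - (\<Sum>j=M..2 * M. ?G (Suc j) - ?G j)"
    unfolding sum_negf[symmetric]
    by (intro sum.cong refl) (simp only: step atLeastAtMost_iff, simp add: real_walk_dist algebra_simps)
  also have "\<dots> = ?G M"
    by (subst sum_Suc_diff) simp_all
  finally have "walk_mean real M = 2 * real M * real (2 * M choose M) / 4 ^ M"
    by (simp add: walk_mean_def)
  also have "real (2 * M choose M) = 4 ^ M * pochhammer (1 / 2) M / fact M"
    using binomial_fact[of M "2 * M", where ?'a = real] fact_double[of M, where ?'a = real]
    by (simp add: power_mult)
  finally show ?thesis by simp
qed

text \<open>A Newton basis, in the variable \<open>k\<^sup>2\<close>, for the even part (\<open>a = 0\<close>) and the odd part (\<open>a = 1\<close>, after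
splitting off a factor \<open>k\<close>) of a polynomial in \<open>k\<close>. The nodes are the ones for which the recursion
\<open>walk_mean_square_mult\<close> sends one Gamma quotient to a single one, see \<open>walk_mean_ladder\<close>.\<close>

definition ladder :: "nat \<Rightarrow> nat \<Rightarrow> real poly" where
  "ladder a s = (\<Prod>j<s. [:- (2 * (real j + real a))\<^sup>2, 1:])"

lemma degree_ladder: "degree (ladder a s) = s"
  unfolding ladder_def by (subst degree_prod_sum_eq) auto

lemma coeff_ladder_top: "coeff (ladder a s) s = 1"
proof -
  have "lead_coeff (ladder a s) = 1"
    unfolding ladder_def lead_coeff_prod by simp
  then show ?thesis by (simp add: degree_ladder)
qed

lemma ladder_reduce:
  assumes "degree P \<le> Suc d"
  obtains R where "degree R \<le> d" "P = smult (coeff P (Suc d)) (ladder a (Suc d)) + R"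
proof
  let ?R = "P - smult (coeff P (Suc d)) (ladder a (Suc d))"
  show "degree ?R \<le> d"
  proof (rule degree_le, intro allI impI)
    fix i assume "d < i"
    then consider "i = Suc d" | "Suc d < i" by linarith
    then show "coeff ?R i = 0"
    proof cases
      case 1
      then show ?thesis by (simp add: coeff_ladder_top)
    next
      case 2
      then show ?thesis using assms by (simp add: coeff_eq_0 degree_ladder)
    qed
  qed
qed simp

text \<open>Let \<open>t = s + a\<close>, \<open>\<alpha> = 1 - a/2\<close> and \<open>w\<^sub>t(M) = pochhammer \<alpha> M / fact (M - t)\<close>. The right-hand side of the
recursion for \<open>k\<^sup>2\<close>, applied to \<open>w\<^sub>t\<close>, is \<open>(4s + 2 + 2a) w\<^sub>t\<^sub>+\<^sub>1 + 4t\<^sup>2 w\<^sub>t\<close> in both cases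
\<open>a = 0\<close> and \<open>a = 1\<close>; the node \<open>(2t)\<^sup>2\<close> removes the second term.\<close>

lemma walk_mean_ladder:
  assumes "a \<le> 1" "s + a \<le> M"
  shows "walk_mean (\<lambda>k. real k ^ a * poly (ladder a s) ((real k)\<^sup>2)) M =
    2 ^ a * (\<Prod>j<s. 4 * real j + 2 + 2 * real a) * pochhammer (1 - real a / 2) M / fact (M - (s + a))"
  using assms(2)
proof (induction s arbitrary: M)
  case 0
  consider "a = 0" | "a = 1" using assms(1) by linarith
  then show ?case
  proof cases
    case 1
    then show ?thesis by (simp add: ladder_def walk_mean_one pochhammer_fact[symmetric])
  next
    case 2
    then obtain M' where "M = Suc M'" using 0 by (cases M) auto
    moreover have half: "1 - real a / 2 = 1 / 2" using 2 by simp
    ultimately show ?thesis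
      unfolding half using 2 by (simp add: ladder_def walk_mean_id del: of_nat_Suc)
  qed
next
  case (Suc s)
  define t where "t = s + a"
  define D where "D = M - Suc t"
  have M: "M = Suc (D + t)" using Suc.prems by (simp add: D_def t_def)
  define G where "G = (\<lambda>k. real k ^ a * poly (ladder a s) ((real k)\<^sup>2))"
  define c where "c = 2 ^ a * (\<Prod>j<s. 4 * real j + 2 + 2 * real a)"
  define P where "P = pochhammer (1 - real a / 2) (D + t)"
  have IH1: "walk_mean G (Suc (D + t)) = c * (P * (1 - real a / 2 + real (D + t))) / (real (Suc D) * fact D)"
    using Suc.IH[of "Suc (D + t)"]
    by (simp add: G_def c_def P_def pochhammer_Suc Suc_diff_le flip: t_def)
  have IH2: "walk_mean G (D + t) = c * P / fact D"
    using Suc.IH[of "D + t"] by (simp add: G_def c_def P_def flip: t_def)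
  have "walk_mean (\<lambda>k. real k ^ a * poly (ladder a (Suc s)) ((real k)\<^sup>2)) M =
      walk_mean (\<lambda>k. (real k)\<^sup>2 * G k + (- (2 * real t)\<^sup>2) * G k) M"
    by (intro arg_cong[where f = "\<lambda>g. walk_mean g M"])
      (simp add: fun_eq_iff G_def ladder_def t_def algebra_simps)
  also have "\<dots> = 4 * (real M)\<^sup>2 * walk_mean G M - 2 * real M * (2 * real M - 1) * walk_mean G (D + t)
      - (2 * real t)\<^sup>2 * walk_mean G M"
    unfolding walk_mean_add walk_mean_cmult unfolding M walk_mean_square_mult by simp
  also have "\<dots> = c * (4 * real s + 2 + 2 * real a) * (P * (1 - real a / 2 + real (D + t))) / fact D"
  proof -
    \<comment> \<open>both sides carry the factor \<open>M - t = D + 1\<close>, whose cancellation lowers the factorial\<close>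
    have "(4 * (real M)\<^sup>2 - (2 * real t)\<^sup>2) * (1 - real a / 2 + real (D + t)) -
        2 * real M * (2 * real M - 1) * real (Suc D) =
        (4 * real s + 2 + 2 * real a) * (1 - real a / 2 + real (D + t)) * real (Suc D)"
    proof -
      consider "a = 0" | "a = 1" using assms(1) by linarith
      then show ?thesis
        by cases (simp_all add: M t_def power2_eq_square field_simps)
    qed
    moreover have "A * (c * (P * u) / (e * F)) - X * (c * P / F) - B * (c * (P * u) / (e * F)) =
        c * y * (P * u) / F"
      if "(A - B) * u - X * e = y * u * e" "e \<noteq> 0" "F \<noteq> 0" for A B X u e F y :: real
    proof -
      have "A * (c * (P * u) / (e * F)) - X * (c * P / F) - B * (c * (P * u) / (e * F)) =
          c * P * ((A - B) * u - X * e) / (e * F)"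
        using that(2,3) by (simp add: field_simps)
      also have "\<dots> = c * y * (P * u) / F" using that by simp
      finally show ?thesis .
    qed
    ultimately show ?thesis
      unfolding IH2 unfolding M IH1 by simp
  qed
  also have "\<dots> = 2 ^ a * (\<Prod>j<Suc s. 4 * real j + 2 + 2 * real a) *
      pochhammer (1 - real a / 2) M / fact (M - (Suc s + a))"
    by (simp add: M c_def P_def pochhammer_Suc t_def)
  finally show ?case .
qed

text \<open>Gamma quotients are closed under differences:
\<open>(\<alpha>)\<^sub>N / L! - (\<alpha>)\<^sub>N\<^sub>+\<^sub>1 / (L+1)! = (L + 1 - \<alpha> - N) (\<alpha>)\<^sub>N / (L+1)!\<close>, and for \<open>L = N + m - t\<close> the
factor \<open>L + 1 - \<alpha> - N\<close> does not depend on \<open>N\<close>.\<close>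

lemma bump_mean_pochhammer:
  assumes "\<And>M. t \<le> M \<Longrightarrow> walk_mean g M = c * pochhammer \<alpha> M / fact (M - t)" "t \<le> N"
  shows "bump_mean g m N = c * pochhammer (1 - \<alpha> - real t) m * pochhammer \<alpha> N / fact (N + m - t)"
  using assms(2)
proof (induction m arbitrary: N)
  case 0
  then show ?case by (simp add: assms(1))
next
  case (Suc m)
  define q where "q = c * pochhammer (1 - \<alpha> - real t) m * pochhammer \<alpha> N / fact (N + m - t)"
  have d: "Suc (N + m) - t = Suc (N + m - t)" using Suc.prems by simp
  have "bump_mean g (Suc m) N = q - q * (\<alpha> + real N) / real (Suc (N + m - t))"
    using Suc by (simp add: q_def d pochhammer_Suc mult_ac del: of_nat_Suc)
  also have "\<dots> = q * (1 - \<alpha> - real t + real m) / real (Suc (N + m - t))"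
    using Suc.prems by (simp add: field_simps of_nat_diff)
  finally show ?case by (simp add: q_def d pochhammer_Suc mult_ac del: of_nat_Suc)
qed

lemma bump_mean_ladder:
  assumes "a \<le> 1" "s + a \<le> N"
  shows "bump_mean (\<lambda>k. real k ^ a * poly (ladder a s) ((real k)\<^sup>2)) m N =
    2 ^ a * (\<Prod>j<s. 4 * real j + 2 + 2 * real a) * pochhammer (- (real s + real a / 2)) m *
    pochhammer (1 - real a / 2) N / fact (N + m - (s + a))"
proof -
  have "- (real s + real a / 2) = 1 - (1 - real a / 2) - real (s + a)" by simp
  then show ?thesis
    using bump_mean_pochhammer[OF walk_mean_ladder[OF assms(1)] assms(2), of m] by (simp only:)
qed

section \<open>Even and odd parts\<close>

text \<open>On each basis element the factor \<open>pochhammer (- s) m\<close> occurs, which vanishes for \<open>s < m\<close>. This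
expresses that a differential operator of order \<open>2d < 2m\<close> kills \<open>x\<^sup>2\<^sup>m (1 - x\<^sup>2)\<^sup>N\<close> at \<open>0\<close>.\<close>

lemma bump_mean_even:
  assumes "degree P \<le> d" "d < m" "d \<le> N"
  shows "bump_mean (\<lambda>k. poly P ((real k)\<^sup>2)) m N = 0"
proof -
  have ladder0: "bump_mean (\<lambda>k. poly (ladder 0 s) ((real k)\<^sup>2)) m N = 0" if "s \<le> d" for s
    using bump_mean_ladder[of 0 s N m] assms that pochhammer_of_nat_eq_0_lemma[of s m, where ?'a = real]
    by simp
  have "degree P \<le> e \<Longrightarrow> e \<le> d \<Longrightarrow> bump_mean (\<lambda>k. poly P ((real k)\<^sup>2)) m N = 0" for e
  proof (induction e arbitrary: P)
    case 0
    then obtain c where "P = [:c:]" by (auto elim: degree_eq_zeroE)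
    then show ?case
      using ladder0[of 0] bump_mean_cmult[of c "\<lambda>k. 1" m N] by (simp add: ladder_def)
  next
    case (Suc e)
    obtain R where R: "degree R \<le> e" "P = smult (coeff P (Suc e)) (ladder 0 (Suc e)) + R"
      using ladder_reduce[OF Suc.prems(1), of 0] by blast
    show ?case
      using Suc.IH[OF R(1)] Suc.prems(2) ladder0[of "Suc e"]
      by (subst R(2)) (simp add: bump_mean_add bump_mean_cmult)
  qed
  then show ?thesis using assms(1) by blast
qed

text \<open>For \<open>m > d\<close> this is a nonzero number of sign \<open>(-1)\<^sup>d\<^sup>+\<^sup>1\<close>: exactly the first \<open>d + 1\<close> factors of the
Pochhammer symbol are negative, and a half-integer start avoids \<open>0\<close>.\<close>

definition odd_limit :: "nat \<Rightarrow> nat \<Rightarrow> real" where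
  "odd_limit d m = 2 * (\<Prod>j<d. 4 + 4 * real j) * pochhammer (- (real d + 1 / 2)) m"

lemma bump_mean_odd_ladder:
  assumes "d < m" "d < N"
  shows "bump_mean (\<lambda>k. real k * poly (ladder 1 d) ((real k)\<^sup>2)) m N *
    fact (N + m - Suc d) / pochhammer (1 / 2) N = odd_limit d m"
proof -
  have "pochhammer (1 / 2 :: real) N \<noteq> 0"
    using pochhammer_pos[of "1 / 2 :: real" N] by simp
  then show ?thesis
    using bump_mean_ladder[of 1 d N m] assms by (simp add: odd_limit_def)
qed

text \<open>In the Newton basis the element of degree \<open>d\<close> contributes a constant after this scaling. The
scaling factor for degree \<open>d\<close> is \<open>N + m - d - 1\<close> times the one for degree \<open>d + 1\<close>, hence
everything of lower degree disappears in the limit.\<close>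

lemma bump_mean_odd_limit:
  assumes "degree P \<le> d" "d < m"
  shows "(\<lambda>N. bump_mean (\<lambda>k. real k * poly P ((real k)\<^sup>2)) m N *
    fact (N + m - Suc d) / pochhammer (1 / 2) N) \<longlonglongrightarrow> coeff P d * odd_limit d m"
  using assms
proof (induction d arbitrary: P)
  case 0
  then obtain c where c: "P = [:c:]" by (auto elim: degree_eq_zeroE)
  have "\<forall>\<^sub>F N in sequentially. c * odd_limit 0 m =
      bump_mean (\<lambda>k. real k * poly P ((real k)\<^sup>2)) m N * fact (N + m - Suc 0) / pochhammer (1 / 2) N"
    using eventually_gt_at_top[of 0]
  proof eventually_elim
    case (elim N)
    have "odd_limit 0 m = bump_mean real m N * fact (N + m - Suc 0) / pochhammer (1 / 2) N"
      using bump_mean_odd_ladder[OF 0(2) elim] by (simp add: ladder_def)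
    then show ?case
      using bump_mean_cmult[of c real m N] by (simp add: c mult.commute[of _ c])
  qed
  then show ?case by (simp add: c tendsto_eventually eq_commute)
next
  case (Suc d)
  obtain R where R: "degree R \<le> d" "P = smult (coeff P (Suc d)) (ladder 1 (Suc d)) + R"
    using ladder_reduce[OF Suc.prems(1), of 1] by blast
  define S where "S N = bump_mean (\<lambda>k. real k * poly R ((real k)\<^sup>2)) m N *
    fact (N + m - Suc d) / pochhammer (1 / 2) N" for N
  have "S \<longlonglongrightarrow> coeff R d * odd_limit d m"
    unfolding S_def using Suc.IH[OF R(1)] Suc.prems(2) by simp
  moreover have "filterlim (\<lambda>N. real (N + m - Suc d)) at_top sequentially"
  proof (rule filterlim_compose[OF filterlim_real_sequentially], unfold filterlim_at_top, intro allI)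
    fix Z :: nat
    show "\<forall>\<^sub>F N in sequentially. Z \<le> N + m - Suc d"
      using eventually_ge_at_top[of "Z + Suc d"] by eventually_elim simp
  qed
  ultimately have "(\<lambda>N. S N / real (N + m - Suc d)) \<longlonglongrightarrow> 0"
    by (intro real_tendsto_divide_at_top)
  then have lim: "(\<lambda>N. coeff P (Suc d) * odd_limit (Suc d) m + S N / real (N + m - Suc d))
      \<longlonglongrightarrow> coeff P (Suc d) * odd_limit (Suc d) m + 0"
    by (intro tendsto_intros)
  have ev: "\<forall>\<^sub>F N in sequentially.
      coeff P (Suc d) * odd_limit (Suc d) m + S N / real (N + m - Suc d) =
      bump_mean (\<lambda>k. real k * poly P ((real k)\<^sup>2)) m N * fact (N + m - Suc (Suc d)) / pochhammer (1 / 2) N"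
    using eventually_gt_at_top[of "Suc d"]
  proof eventually_elim
    case (elim N)
    have split: "bump_mean (\<lambda>k. real k * poly P ((real k)\<^sup>2)) m N =
        coeff P (Suc d) * bump_mean (\<lambda>k. real k * poly (ladder 1 (Suc d)) ((real k)\<^sup>2)) m N +
        bump_mean (\<lambda>k. real k * poly R ((real k)\<^sup>2)) m N"
      by (subst R(2), subst bump_mean_cmult[symmetric], subst bump_mean_add[symmetric])
        (simp add: algebra_simps)
    have f: "fact (N + m - Suc d) = real (N + m - Suc d) * fact (N + m - Suc (Suc d))"
      using elim by (subst fact_reduce) auto
    have "S N / real (N + m - Suc d) = bump_mean (\<lambda>k. real k * poly R ((real k)\<^sup>2)) m N *
        fact (N + m - Suc (Suc d)) / pochhammer (1 / 2) N"
      using elim unfolding S_def f by simp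
    then show ?case
      unfolding split bump_mean_odd_ladder[OF Suc.prems(2) elim, symmetric]
      by (simp add: distrib_right add_divide_distrib)
  qed
  from Lim_transform_eventually[OF lim ev] show ?case by simp
qed

text \<open>Raising \<open>d\<close> by one shifts the start \<open>x\<close> of the Pochhammer symbol to \<open>x - 1\<close>, and
\<open>(x - 1)\<^sub>m (x - 1 + m) = (x - 1) (x)\<^sub>m\<close> with \<open>x - 1 < 0 < x - 1 + m\<close>.\<close>

lemma odd_limit_sign:
  assumes "Suc d < m"
  shows "odd_limit d m * odd_limit (Suc d) m < 0"
proof -
  define x :: real where "x = - (real d + 1 / 2)"
  have shift: "pochhammer (x - 1) m * (x - 1 + real m) = (x - 1) * pochhammer x m"
    using pochhammer_rec[of "x - 1" m] pochhammer_Suc[of "x - 1" m] by simp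
  have "pochhammer x m \<noteq> 0"
  proof
    assume "pochhammer x m = 0"
    then obtain k where "x = - real k" unfolding pochhammer_eq_0_iff by blast
    then have "real (2 * k) = real (2 * d + 1)" by (simp add: x_def)
    then have "2 * k = 2 * d + 1" by (simp only: of_nat_eq_iff)
    then show False by presburger
  qed
  moreover have "0 < x - 1 + real m" "x - 1 < 0" using assms by (simp_all add: x_def)
  ultimately have "(x - 1) * (pochhammer x m)\<^sup>2 / (x - 1 + real m) < 0"
    by (intro divide_neg_pos mult_neg_pos) simp_all
  also have "(x - 1) * (pochhammer x m)\<^sup>2 = pochhammer x m * (pochhammer (x - 1) m * (x - 1 + real m))"
    unfolding shift by (simp add: power2_eq_square)
  also have "\<dots> / (x - 1 + real m) = pochhammer x m * pochhammer (x - 1) m"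
    using \<open>0 < x - 1 + real m\<close> by simp
  finally have neg: "pochhammer x m * pochhammer (x - 1) m < 0" .
  have c: "0 < 2 * (\<Prod>j<e. 4 + 4 * real j)" for e
    by (intro mult_pos_pos prod_pos) auto
  have "odd_limit d m * odd_limit (Suc d) m =
      (2 * (\<Prod>j<d. 4 + 4 * real j)) * (2 * (\<Prod>j<Suc d. 4 + 4 * real j)) *
      (pochhammer x m * pochhammer (x - 1) m)"
    by (simp add: odd_limit_def x_def)
  then show ?thesis using neg c[of d] c[of "Suc d"] by (simp only: mult_pos_neg mult_pos_pos)
qed

section \<open>The odd part of a multiplier polynomial\<close>

lemma poly_even_odd_split:
  fixes p :: "real poly"
  obtains E Q where "\<And>x. poly p x = poly E (x\<^sup>2) + x * poly Q (x\<^sup>2)"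
    "\<And>i. coeff p (2 * i) = coeff E i" "\<And>i. coeff p (2 * i + 1) = coeff Q i"
proof -
  have "\<exists>E Q. (\<forall>x. poly p x = poly E (x\<^sup>2) + x * poly Q (x\<^sup>2)) \<and>
    (\<forall>i. coeff p (2 * i) = coeff E i) \<and> (\<forall>i. coeff p (2 * i + 1) = coeff Q i)"
  proof (induction p)
    case 0
    show ?case by (intro exI[of _ 0]) simp
  next
    case (pCons a p)
    then obtain E Q where *: "\<And>x. poly p x = poly E (x\<^sup>2) + x * poly Q (x\<^sup>2)"
      "\<And>i. coeff p (2 * i) = coeff E i" "\<And>i. coeff p (2 * i + 1) = coeff Q i" by blast
    have "coeff (pCons a p) (2 * i) = coeff (pCons a Q) i" for i
      using *(3)[of "i - 1"] by (cases i) simp_all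
    then show ?case
      using * by (intro exI[of _ "pCons a Q"] exI[of _ E]) (auto simp: algebra_simps power2_eq_square)
  qed
  then show ?thesis using that by blast
qed

text \<open>The scaled means for \<open>\<gamma>\<^sub>k\<close> and \<open>k\<^sup>2 \<gamma>\<^sub>k\<close> tend to the leading coefficient of \<open>Q\<close> times constants of
opposite signs, while their product is nonnegative for every \<open>N\<close> by the Laguerre inequality.\<close>

lemma multiplier_odd_part_zero:
  assumes "Cheb_multiplier_sequence \<gamma>"
    and \<gamma>: "\<And>k. \<gamma> k = poly E ((real k)\<^sup>2) + real k * poly Q ((real k)\<^sup>2)"
  shows "Q = 0"
proof (rule ccontr)
  assume "Q \<noteq> 0"
  define d where "d = degree Q"
  \<comment> \<open>large enough to kill the even parts, of degrees \<open>degree E\<close> and \<open>degree E + 1\<close>, and to have \<open>d + 1 < m\<close>\<close>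
  define m where "m = degree E + d + 3"
  define scale where "scale e N = fact (N + m - Suc e) / pochhammer (1 / 2 :: real) N" for e N
  have scale_pos: "0 < scale e N" for e N
    unfolding scale_def by (intro divide_pos_pos pochhammer_pos) simp_all
  have \<gamma>_sq: "(real k)\<^sup>2 * \<gamma> k = poly (pCons 0 E) ((real k)\<^sup>2) + real k * poly (pCons 0 Q) ((real k)\<^sup>2)" for k
    unfolding \<gamma> by (simp add: algebra_simps)
  have 1: "(\<lambda>N. bump_mean (\<lambda>k. real k * poly Q ((real k)\<^sup>2)) m N * scale d N)
      \<longlonglongrightarrow> coeff Q d * odd_limit d m"
    using bump_mean_odd_limit[of Q d m] by (simp add: scale_def d_def m_def)
  have 2: "(\<lambda>N. bump_mean (\<lambda>k. real k * poly (pCons 0 Q) ((real k)\<^sup>2)) m N * scale (Suc d) N)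
      \<longlonglongrightarrow> coeff Q d * odd_limit (Suc d) m"
    using bump_mean_odd_limit[of "pCons 0 Q" "Suc d" m] degree_pCons_le[of 0 Q]
    by (simp add: scale_def d_def m_def)
  have "\<forall>\<^sub>F N in sequentially. 0 \<le> (bump_mean (\<lambda>k. real k * poly Q ((real k)\<^sup>2)) m N * scale d N) *
      (bump_mean (\<lambda>k. real k * poly (pCons 0 Q) ((real k)\<^sup>2)) m N * scale (Suc d) N)"
    using eventually_ge_at_top[of m]
  proof eventually_elim
    case (elim N)
    have "bump_mean \<gamma> m N = bump_mean (\<lambda>k. real k * poly Q ((real k)\<^sup>2)) m N"
      using bump_mean_even[of E "degree E" m N] elim
      by (subst \<gamma>[abs_def], subst bump_mean_add) (simp add: m_def)
    moreover have "bump_mean (\<lambda>k. (real k)\<^sup>2 * \<gamma> k) m N =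
        bump_mean (\<lambda>k. real k * poly (pCons 0 Q) ((real k)\<^sup>2)) m N"
      using bump_mean_even[of "pCons 0 E" "Suc (degree E)" m N] degree_pCons_le[of 0 E] elim
      unfolding \<gamma>_sq bump_mean_add by (simp add: m_def)
    ultimately have nonneg: "0 \<le> bump_mean (\<lambda>k. real k * poly Q ((real k)\<^sup>2)) m N *
        bump_mean (\<lambda>k. real k * poly (pCons 0 Q) ((real k)\<^sup>2)) m N"
      using multiplier_bump_mean_product[OF assms(1), of m N] by simp
    have "0 \<le> scale d N * scale (Suc d) N"
      using scale_pos by (simp add: less_imp_le)
    with nonneg have "0 \<le> (bump_mean (\<lambda>k. real k * poly Q ((real k)\<^sup>2)) m N *
        bump_mean (\<lambda>k. real k * poly (pCons 0 Q) ((real k)\<^sup>2)) m N) * (scale d N * scale (Suc d) N)"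
      by (rule mult_nonneg_nonneg)
    then show ?case by (simp only: mult_ac)
  qed
  then have "0 \<le> (coeff Q d * odd_limit d m) * (coeff Q d * odd_limit (Suc d) m)"
    by (rule tendsto_lowerbound[OF tendsto_mult[OF 1 2]]) simp
  also have "\<dots> = (coeff Q d)\<^sup>2 * (odd_limit d m * odd_limit (Suc d) m)"
    by (simp add: power2_eq_square)
  also have "\<dots> < 0"
    using \<open>Q \<noteq> 0\<close> by (intro mult_pos_neg odd_limit_sign) (simp_all add: d_def m_def)
  finally show False by simp
qed

theorem theorem16:
  fixes n :: nat and b :: "nat \<Rightarrow> real" and \<gamma> :: "nat \<Rightarrow> real"
  assumes "\<And>k. \<gamma> k = real k ^ n + (\<Sum>i=1..n. b i * real k ^ (n - i))"
    and "Cheb_multiplier_sequence \<gamma>"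
  shows "even n \<and> (\<forall>i. 1 \<le> i \<and> i \<le> n \<and> odd i \<longrightarrow> b i = 0) \<and>
    (\<forall>p::real poly. (\<forall>k. poly p (real k) = \<gamma> k) \<longrightarrow>
       (\<forall>j. odd j \<longrightarrow> coeff p j = 0) \<and> (\<forall>x. poly p (- x) = poly p x))"
proof -
  define g :: "real poly" where "g = monom 1 n + (\<Sum>i=1..n. monom (b i) (n - i))"
  have g: "poly g (real k) = \<gamma> k" for k
    by (simp add: assms(1) g_def poly_monom poly_sum)
  obtain E Q where EO: "\<And>x. poly g x = poly E (x\<^sup>2) + x * poly Q (x\<^sup>2)"
    "\<And>i. coeff g (2 * i) = coeff E i" "\<And>i. coeff g (2 * i + 1) = coeff Q i"
    by (rule poly_even_odd_split[of g]) (rule that)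
  have "Q = 0"
    using multiplier_odd_part_zero[OF assms(2)] EO(1) g by metis
  then have odd0: "coeff g j = 0" if "odd j" for j
    using EO(3) that by (elim oddE) simp
  have sym: "poly g (- x) = poly g x" for x
    unfolding EO(1) \<open>Q = 0\<close> by simp
  have top: "coeff g n = 1"
  proof -
    have "(\<Sum>i=1..n. coeff (monom (b i) (n - i)) n) = 0"
      by (intro sum.neutral) auto
    then show ?thesis by (simp add: g_def coeff_sum)
  qed
  then have "even n" using odd0[of n] by auto
  have b_odd: "b i = 0" if i: "1 \<le> i" "i \<le> n" "odd i" for i
  proof -
    have "(\<Sum>l=1..n. coeff (monom (b l) (n - l)) (n - i)) = (\<Sum>l=1..n. if l = i then b i else 0)"
      using i by (intro sum.cong) auto
    then have "coeff g (n - i) = b i"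
      using i by (simp add: g_def coeff_sum)
    then show ?thesis using odd0[of "n - i"] i \<open>even n\<close> by simp
  qed
  have unique: "p = g" if "\<forall>k. poly p (real k) = \<gamma> k" for p
  proof -
    have "range real \<subseteq> {x. poly (p - g) x = 0}" using that g by auto
    moreover have "infinite (range real)" by (simp add: finite_image_iff)
    ultimately have "infinite {x. poly (p - g) x = 0}" using finite_subset by blast
    then show ?thesis using poly_roots_finite[of "p - g"] by auto
  qed
  show ?thesis
  proof (intro conjI allI impI)
    show "b i = 0" if "1 \<le> i \<and> i \<le> n \<and> odd i" for i
      using that b_odd by simp
    show "coeff p j = 0" if "\<forall>k. poly p (real k) = \<gamma> k" "odd j" for p j
      using unique[OF that(1)] odd0[OF that(2)] by simp
    show "poly p (- x) = poly p x" if "\<forall>k. poly p (real k) = \<gamma> k" for p x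
      using unique[OF that] sym by simp
  qed (rule \<open>even n\<close>)
qed

end
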